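(* Let $f,g,h,k$ be complex numbers with $f\neq 0$ and $g\neq 0$, and let $(R_n)_{n\in\mathbb{Z}}$ be the two-sided sequence with $R_0=h$, $R_1=k$ and $R_{n+1}=fR_n+gR_{n-1}$ for all $n\in\mathbb{Z}$. Then for all integers $n$ and $i$, $$(k^{2}-fkh-gh^{2})R_{i+n}+(f^{2}h-fk+gh)R_{i}R_{n}+hg^{2}R_{i-1}R_{n-1}+(fh-k)g\left(R_{n}R_{i-1}+R_{i}R_{n-1}\right)=0.$$
   Context: The paper works with complex functions $f(z),g(z),h(z),k(z)$ evaluated at a fixed $z$, with the standing assumption $f\neq0$, $g\neq0$. Since $g\neq0$, the sequence extends to negative indices via $R_{n-1}=(R_{n+1}-fR_n)/g$. *)

theory Defs
  imports Complex_Main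
begin

end

theory Submission
  imports Defs
begin

text \<open>
  The solutions of the recurrence are closed under linear combinations and translations of the
  index. For fixed \<open>i\<close>, the left-hand side is a linear combination of translates of solutions,
  hence itself a solution in \<open>n\<close>. Since \<open>g \<noteq> 0\<close>, the recurrence can be run in both directions,
  and a solution that vanishes at \<open>0\<close> and \<open>1\<close> is zero.
\<close>

definition second_order_recurrence :: "'a::comm_semiring \<Rightarrow> 'a \<Rightarrow> (int \<Rightarrow> 'a) \<Rightarrow> bool" where
  "second_order_recurrence f g R \<longleftrightarrow> (\<forall>n. R (n + 1) = f * R n + g * R (n - 1))"

lemma second_order_recurrenceI:
  assumes "\<And>n. R (n + 1) = f * R n + g * R (n - 1)"
  shows "second_order_recurrence f g R"
  using assms by (simp add: second_order_recurrence_def)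

lemma second_order_recurrenceD:
  assumes "second_order_recurrence f g R"
  shows "R (n + 1) = f * R n + g * R (n - 1)"
  using assms by (simp add: second_order_recurrence_def)

lemma second_order_recurrence_add:
  assumes "second_order_recurrence f g R" and "second_order_recurrence f g S"
  shows "second_order_recurrence f g (\<lambda>n. R n + S n)"
  by (rule second_order_recurrenceI)
    (simp add: assms[THEN second_order_recurrenceD] algebra_simps)

lemma second_order_recurrence_mult_left:
  assumes "second_order_recurrence f g R"
  shows "second_order_recurrence f g (\<lambda>n. c * R n)"
  by (rule second_order_recurrenceI)
    (simp add: assms[THEN second_order_recurrenceD] algebra_simps)

lemma second_order_recurrence_translate:
  assumes "second_order_recurrence f g R"
  shows "second_order_recurrence f g (\<lambda>n. R (i + n))"
proof (rule second_order_recurrenceI)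
  show "R (i + (n + 1)) = f * R (i + n) + g * R (i + (n - 1))" for n
    using second_order_recurrenceD[OF assms, of "i + n"] by (simp add: algebra_simps)
qed

lemma second_order_recurrence_eq_0:
  fixes R :: "int \<Rightarrow> 'a::idom"
  assumes R: "second_order_recurrence f g R" and "g \<noteq> 0" and "R 0 = 0" and "R 1 = 0"
  shows "R n = 0"
proof -
  have "R n = 0 \<and> R (n + 1) = 0"
  proof (induction n rule: int_induct[where k = 0])
    case base
    show ?case using \<open>R 0 = 0\<close> \<open>R 1 = 0\<close> by simp
  next
    case (step1 i)
    then show ?case using second_order_recurrenceD[OF R, of "i + 1"] by simp
  next
    case (step2 i)
    then show ?case using second_order_recurrenceD[OF R, of i] \<open>g \<noteq> 0\<close> by auto
  qed
  then show ?thesis ..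
qed

lemma second_order_recurrence_addition_formula:
  fixes R S :: "int \<Rightarrow> 'a::idom"
  assumes R: "second_order_recurrence f g R" and S: "second_order_recurrence f g S"
    and "g \<noteq> 0"
  shows "((R 1)\<^sup>2 - f * R 1 * R 0 - g * (R 0)\<^sup>2) * S (i + n)
      + (f\<^sup>2 * R 0 - f * R 1 + g * R 0) * S i * R n
      + R 0 * g\<^sup>2 * S (i - 1) * R (n - 1)
      + (f * R 0 - R 1) * g * (R n * S (i - 1) + S i * R (n - 1)) = 0"
proof -
  define F where "F m =
    ((R 1)\<^sup>2 - f * R 1 * R 0 - g * (R 0)\<^sup>2) * S (i + m)
      + (((f\<^sup>2 * R 0 - f * R 1 + g * R 0) * S i + (f * R 0 - R 1) * g * S (i - 1)) * R m
        + (R 0 * g\<^sup>2 * S (i - 1) + (f * R 0 - R 1) * g * S i) * R (- 1 + m))" for m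
  have R_1: "R 1 = f * R 0 + g * R (- 1)"
    using second_order_recurrenceD[OF R, of 0] by simp
  have S_Suc: "S (i + 1) = f * S i + g * S (i - 1)"
    using S by (rule second_order_recurrenceD)
  have "F n = 0"
  proof (rule second_order_recurrence_eq_0[OF _ \<open>g \<noteq> 0\<close>])
    show "second_order_recurrence f g F"
      unfolding F_def using R S
      by (intro second_order_recurrence_add second_order_recurrence_mult_left
          second_order_recurrence_translate)
    show "F 0 = 0"
      unfolding F_def R_1 by (simp add: algebra_simps power2_eq_square)
    show "F 1 = 0"
      unfolding F_def S_Suc by (simp add: algebra_simps power2_eq_square)
  qed
  then show ?thesis
    unfolding F_def by (simp add: algebra_simps)
qed

theorem theorem4p2:
  fixes f g h k :: complex and R :: "int \<Rightarrow> complex"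
  assumes "f \<noteq> 0" and "g \<noteq> 0"
    and "R 0 = h" and "R 1 = k"
    and "\<And>n. R (n + 1) = f * R n + g * R (n - 1)"
  shows "\<forall>n i :: int.
    (k\<^sup>2 - f * k * h - g * h\<^sup>2) * R (i + n)
      + (f\<^sup>2 * h - f * k + g * h) * R i * R n
      + h * g\<^sup>2 * R (i - 1) * R (n - 1)
      + (f * h - k) * g * (R n * R (i - 1) + R i * R (n - 1)) = 0"
proof -
  have "second_order_recurrence f g R"
    using assms(5) by (rule second_order_recurrenceI)
  from second_order_recurrence_addition_formula[OF this this \<open>g \<noteq> 0\<close>]
  show ?thesis
    unfolding \<open>R 0 = h\<close> \<open>R 1 = k\<close> by blast
qed

end
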